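(* Let $n\ge1$ and let $a_1,\dots,a_{n-1},b_1,\dots,b_{n-1}$ be complex parameters of modulus strictly less than $1$. For every signature $\lambda=(\lambda_1\ge\cdots\ge\lambda_n)\in\mathbb{Z}^n$, $$\mathsf f_\lambda(x_1,\dots,x_n|a_1,\dots,a_{n-1};b_1,\dots,b_{n-1})=\mathsf f_{\lambda^{\mathrm{rev}}}(x_1^{-1},\dots,x_n^{-1}|b_{n-1},\dots,b_1;a_{n-1},\dots,a_1),$$ where $\lambda^{\mathrm{rev}}=(-\lambda_n\ge\cdots\ge-\lambda_1)$.
   Context: Let $q\in\mathbb{C}$ with $|q|<1$, and $(z;q)_k=\prod_{i=0}^{k-1}(1-zq^i)$ for $k\in\mathbb{Z}_{\ge0}$. $\mathbb{Y}_n$ is the set of integer partitions $\lambda=(\lambda_1\ge\dots\ge\lambda_n\ge0)$ with at most $n$ nonzero parts, with $\lambda_i=0$ for $i>n$; $|\lambda|=\sum_i\lambda_i$. For partitions, $\mu\preceq\lambda$ means $\lambda_i\ge\mu_i\ge\lambda_{i+1}$ for all $i\ge1$. Spin $q$-Whittaker polynomials: let $c_1,\dots,c_n,d_1,\dots,d_n$ be complex parameters of modulus $<1$. For $\lambda\in\mathbb{Y}_n$, $\mu\in\mathbb{Y}_{n-1}$ set $$\mathbb{F}_{\lambda/\mu}(x|c_1,\dots,c_n;d_1,\dots,d_n)=\mathbf 1_{\mu\preceq\lambda}\,x^{|\lambda|-|\mu|}\prod_{r=1}^n\frac{(c_r/x;q)_{\lambda_r-\mu_r}(xd_r;q)_{\mu_r-\lambda_{r+1}}(q;q)_{\lambda_r-\lambda_{r+1}}}{(q;q)_{\lambda_r-\mu_r}(q;q)_{\mu_r-\lambda_{r+1}}(c_rd_r;q)_{\lambda_r-\lambda_{r+1}}}.$$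 Define recursively, starting from $\mathbb{F}_\varnothing=1$ in zero variables, $$\mathbb{F}_\lambda(x_1,\dots,x_n|c_1,\dots,c_n;d_1,\dots,d_n)=\sum_{\mu\in\mathbb{Y}_{n-1},\,\mu\preceq\lambda}\mathbb{F}_\mu(x_1,\dots,x_{n-1}|c_2,\dots,c_n;d_1,\dots,d_{n-1})\,\mathbb{F}_{\lambda/\mu}(x_n|c_1,\dots,c_n;d_1,\dots,d_n).$$ These are polynomials, known to be symmetric in $x_1,\dots,x_n$. For $\lambda\in\mathbb{Y}_n$ set $$\mathsf f_\lambda(x_1,\dots,x_n|c_1,\dots,c_{n-1};d_1,\dots,d_{n-1})=\mathbb{F}_\lambda(x_1,\dots,x_n|c_1,\dots,c_{n-1},0;d_1,\dots,d_n),$$ which does not depend on $d_n$. For an arbitrary signature $\lambda\in\mathbb{Z}^n$, $\lambda_1\ge\dots\ge\lambda_n$, the Laurent polynomial $\mathsf f_\lambda$ is defined by $$\mathsf f_\lambda(x_1,\dots,x_n|\boldsymbol c;\boldsymbol d)=(x_1\cdots x_n)^{\lambda_n}\,\mathsf f_{(\lambda_1-\lambda_n,\dots,\lambda_{n-1}-\lambda_n,0)}(x_1,\dots,x_n|\boldsymbol c;\boldsymbol d),$$ which is consistent with the definition for partitions. *)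

theory Defs
  imports Complex_Main "HOL-Library.FuncSet"
begin

text \<open>
  Finite sequences are functions on \<open>nat\<close>, indexed from 0: the entry with index \<open>i\<close> in the usual
  1-based notation is the value at \<open>i - 1\<close>.  Polynomials and Laurent polynomials in
  \<open>x\<^sub>1, \<dots>, x\<^sub>n\<close> are represented by their values at points of \<open>(\<complex> - {0})\<^sup>n\<close>; by division by
  zero, the formula for \<open>spin_qW_skew\<close> does not extend the polynomial to \<open>x = 0\<close>.
\<close>

definition qpoch :: "complex \<Rightarrow> complex \<Rightarrow> nat \<Rightarrow> complex" where
  "qpoch z q k = (\<Prod>i<k. 1 - z * q ^ i)"

definition partitions_le :: "nat \<Rightarrow> (nat \<Rightarrow> nat) set" where
  "partitions_le n = {lam. antimono lam \<and> (\<forall>i\<ge>n. lam i = 0)}"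

definition interlaces :: "(nat \<Rightarrow> nat) \<Rightarrow> (nat \<Rightarrow> nat) \<Rightarrow> bool" where
  "interlaces mu lam \<longleftrightarrow> (\<forall>i. mu i \<le> lam i \<and> lam (Suc i) \<le> mu i)"

definition spin_qW_skew ::
  "complex \<Rightarrow> nat \<Rightarrow> (nat \<Rightarrow> nat) \<Rightarrow> (nat \<Rightarrow> nat) \<Rightarrow> complex \<Rightarrow>
   (nat \<Rightarrow> complex) \<Rightarrow> (nat \<Rightarrow> complex) \<Rightarrow> complex" where
  "spin_qW_skew q n lam mu x c d =
    (if interlaces mu lam then
       x ^ ((\<Sum>i<n. lam i) - (\<Sum>i<n. mu i)) *
       (\<Prod>r<n.
          (qpoch (c r / x) q (lam r - mu r) * qpoch (x * d r) q (mu r - lam (Suc r)) *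
           qpoch q q (lam r - lam (Suc r))) /
          (qpoch q q (lam r - mu r) * qpoch q q (mu r - lam (Suc r)) *
           qpoch (c r * d r) q (lam r - lam (Suc r))))
     else 0)"

fun spin_qW ::
  "complex \<Rightarrow> nat \<Rightarrow> (nat \<Rightarrow> nat) \<Rightarrow> (nat \<Rightarrow> complex) \<Rightarrow>
   (nat \<Rightarrow> complex) \<Rightarrow> (nat \<Rightarrow> complex) \<Rightarrow> complex" where
  "spin_qW q 0 lam x c d = 1"
| "spin_qW q (Suc n) lam x c d =
    (\<Sum>mu | mu \<in> partitions_le n \<and> interlaces mu lam.
       spin_qW q n mu x (\<lambda>i. c (Suc i)) d * spin_qW_skew q (Suc n) lam mu (x n) c d)"

text \<open>The sum above never degenerates to a sum over an infinite set.\<close>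

lemma finite_interlacing: "finite {mu. mu \<in> partitions_le n \<and> interlaces mu lam}"
proof (rule finite_subset)
  let ?M = "Max (lam ` {..<n})"
  show "{mu. mu \<in> partitions_le n \<and> interlaces mu lam}
      \<subseteq> {f. \<forall>i. (i \<in> {..<n} \<longrightarrow> f i \<in> {..?M}) \<and> (i \<notin> {..<n} \<longrightarrow> f i = 0)}"
  proof (clarsimp simp: partitions_le_def interlaces_def)
    fix mu i
    assume "\<forall>i. mu i \<le> lam i \<and> lam (Suc i) \<le> mu i" and "i < n"
    then show "mu i \<le> ?M"
      by (meson Max_ge finite_imageI finite_lessThan imageI lessThan_iff order_trans)
  qed
  show "finite {f. \<forall>i. (i \<in> {..<n} \<longrightarrow> f i \<in> {..?M}) \<and> (i \<notin> {..<n} \<longrightarrow> f i = (0::nat))}"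
    by (rule finite_set_of_finite_funs) auto
qed

text \<open>
  The \<open>n\<close>-th \<open>c\<close>-parameter is set to 0.  The value then does not depend on the \<open>n\<close>-th
  \<open>d\<close>-parameter (lemma \<open>spin_qW_last_indep\<close>), which is also set to 0, so that only the
  first \<open>n - 1\<close> entries of \<open>c\<close> and \<open>d\<close> matter.
\<close>

definition spin_f_part ::
  "complex \<Rightarrow> nat \<Rightarrow> (nat \<Rightarrow> nat) \<Rightarrow> (nat \<Rightarrow> complex) \<Rightarrow>
   (nat \<Rightarrow> complex) \<Rightarrow> (nat \<Rightarrow> complex) \<Rightarrow> complex" where
  "spin_f_part q n lam x c d = spin_qW q n lam x (c(n - 1 := 0)) (d(n - 1 := 0))"

lemma spin_qW_skew_last_indep:
  assumes "mu n = 0" "c n = 0"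
  shows "spin_qW_skew q (Suc n) lam mu x c (d(n := e)) = spin_qW_skew q (Suc n) lam mu x c d"
  using assms by (simp add: spin_qW_skew_def qpoch_def)

lemma spin_qW_cong_d:
  assumes "\<And>i. i < n \<Longrightarrow> d i = d' i"
  shows "spin_qW q n lam x c d = spin_qW q n lam x c d'"
  using assms
proof (induction n arbitrary: lam c)
  case (Suc n)
  have "spin_qW q n mu x (\<lambda>i. c (Suc i)) d = spin_qW q n mu x (\<lambda>i. c (Suc i)) d'" for mu
    using Suc by simp
  moreover have "spin_qW_skew q (Suc n) lam mu (x n) c d = spin_qW_skew q (Suc n) lam mu (x n) c d'" for mu
    using Suc.prems by (simp add: spin_qW_skew_def)
  ultimately show ?case by simp
qed simp

lemma spin_qW_last_indep:
  assumes "n \<ge> 1" "c (n - 1) = 0"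
  shows "spin_qW q n lam x c (d(n - 1 := e)) = spin_qW q n lam x c d"
proof -
  obtain m where n: "n = Suc m" using assms(1) by (cases n) auto
  have "spin_qW q m mu x (\<lambda>i. c (Suc i)) (d(m := e)) = spin_qW q m mu x (\<lambda>i. c (Suc i)) d" for mu
    by (rule spin_qW_cong_d) simp
  then show ?thesis
    using assms by (auto simp: n partitions_le_def spin_qW_skew_last_indep intro!: sum.cong)
qed

text \<open>
  The Laurent polynomial attached to a signature \<open>lam 0 \<ge> \<dots> \<ge> lam (n - 1)\<close> (with \<open>n \<ge> 1\<close>).
\<close>

definition spin_f ::
  "complex \<Rightarrow> nat \<Rightarrow> (nat \<Rightarrow> int) \<Rightarrow> (nat \<Rightarrow> complex) \<Rightarrow>
   (nat \<Rightarrow> complex) \<Rightarrow> (nat \<Rightarrow> complex) \<Rightarrow> complex" where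
  "spin_f q n lam x c d =
    (\<Prod>i<n. x i) powi (lam (n - 1)) *
    spin_f_part q n (\<lambda>i. if i < n then nat (lam i - lam (n - 1)) else 0) x c d"

text \<open>Reversal of the sequence \<open>s 0, \<dots>, s (m - 1)\<close>; the entries from index \<open>m\<close> on are irrelevant.\<close>

definition rev_seq :: "nat \<Rightarrow> (nat \<Rightarrow> 'a) \<Rightarrow> nat \<Rightarrow> 'a" where
  "rev_seq m s = (\<lambda>i. s (m - 1 - i))"

definition sig_rev :: "nat \<Rightarrow> (nat \<Rightarrow> int) \<Rightarrow> nat \<Rightarrow> int" where
  "sig_rev n lam = (\<lambda>i. - rev_seq n lam i)"

end

theory Submission
  imports Defs
begin

text \<open>
  Unfolding the branching rule turns \<open>f\<^sub>\<lambda>\<close> into a sum over Gelfand--Tsetlin patterns with top row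
  \<open>\<lambda>\<close>.  The symmetry holds pattern by pattern: negate all entries of a pattern and reverse each of
  its rows.

  To see this, look at one step \<open>\<mu> \<preceq> \<lambda>\<close> of the branching.  Because the last \<open>c\<close>-parameter is 0 and
  \<open>\<mu>\<^sub>n = 0\<close>, the factor \<open>r = n\<close> of the weight is 1.  The other factors see only the differences
  \<open>\<lambda>\<^sub>r - \<mu>\<^sub>r\<close> and \<open>\<mu>\<^sub>r - \<lambda>\<^bsub>r+1\<^esub>\<close>, so the rule makes sense for integer entries, and shifting all entries
  by \<open>k\<close> only multiplies the sum by \<open>(x\<^sub>1 \<cdots> x\<^sub>n)\<^sup>k\<close> (\<open>gt_sum_shift\<close>).  Hence the rule computes \<open>f\<^sub>\<lambda>\<close> for
  every signature (\<open>spin_f_eq_gt_sum\<close>).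

  Passing from \<open>\<lambda>, \<mu>\<close> to \<open>\<lambda>\<^sup>r\<^sup>e\<^sup>v, \<mu>\<^sup>r\<^sup>e\<^sup>v\<close> negates \<open>\<bar>\<lambda>\<bar> - \<bar>\<mu>\<bar>\<close>, which inverting \<open>x\<^sub>n\<close> compensates, and
  exchanges \<open>\<lambda>\<^sub>r - \<mu>\<^sub>r\<close> with \<open>\<mu>\<^sub>s - \<lambda>\<^bsub>s+1\<^esub>\<close>, where \<open>s = n - r\<close>.  In the weight the first difference goes
  with \<open>a\<^sub>r / x\<^sub>n\<close> and the second with \<open>x\<^sub>n b\<^sub>r\<close>, and these are exchanged as well when \<open>x\<^sub>n\<close> is inverted
  and the parameters are swapped and reversed.  So the weights agree term by term, and the
  parameters left for the smaller pattern, \<open>a\<^sub>2, \<dots>, a\<^bsub>n-1\<^esub>\<close> and \<open>b\<^sub>1, \<dots>, b\<^bsub>n-2\<^esub>\<close>, are again swapped and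
  reversed, which makes the induction work (\<open>gt_sum_rev\<close>).
\<close>

section \<open>Branching over signatures\<close>

text \<open>
  One factor of the branching weight, as a function of the gaps \<open>j = \<lambda>\<^sub>r - \<mu>\<^sub>r\<close> and
  \<open>k = \<mu>\<^sub>r - \<lambda>\<^bsub>r+1\<^esub>\<close>; in these variables its symmetry is visible.
\<close>

definition gt_weight ::
  "complex \<Rightarrow> complex \<Rightarrow> complex \<Rightarrow> complex \<Rightarrow> nat \<Rightarrow> nat \<Rightarrow> complex" where
  "gt_weight q x a b j k =
    (qpoch (a / x) q j * qpoch (x * b) q k * qpoch q q (j + k)) /
    (qpoch q q j * qpoch q q k * qpoch (a * b) q (j + k))"

definition gt_rows :: "nat \<Rightarrow> (nat \<Rightarrow> int) \<Rightarrow> (nat \<Rightarrow> int) set" where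
  "gt_rows n lam = (\<Pi>\<^sub>E i\<in>{..<n}. {lam (Suc i)..lam i})"

text \<open>
  The branching rule of \<open>f\<close> with integer entries.  The product runs over \<open>r < n\<close> only, since the
  factor of the last row index is 1 when the last \<open>c\<close>-parameter is 0.
\<close>

fun gt_sum ::
  "complex \<Rightarrow> nat \<Rightarrow> (nat \<Rightarrow> int) \<Rightarrow> (nat \<Rightarrow> complex) \<Rightarrow>
   (nat \<Rightarrow> complex) \<Rightarrow> (nat \<Rightarrow> complex) \<Rightarrow> complex" where
  "gt_sum q 0 lam x a b = 1"
| "gt_sum q (Suc n) lam x a b =
    (\<Sum>mu\<in>gt_rows n lam. gt_sum q n mu x (\<lambda>i. a (Suc i)) b *
       (x n powi ((\<Sum>i<Suc n. lam i) - (\<Sum>i<n. mu i)) *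
        (\<Prod>r<n. gt_weight q (x n) (a r) (b r) (nat (lam r - mu r)) (nat (mu r - lam (Suc r))))))"

lemma gt_rowsD:
  assumes "mu \<in> gt_rows n lam" "i < n"
  shows "lam (Suc i) \<le> mu i" "mu i \<le> lam i"
  using assms by (auto simp: gt_rows_def PiE_iff)

lemma gt_weight_swap:
  assumes "x \<noteq> 0"
  shows "gt_weight q (inverse x) b a k j = gt_weight q x a b j k"
  using assms by (simp add: gt_weight_def field_simps)

lemma gt_sum_cong:
  assumes "\<And>i. i < n \<Longrightarrow> lam i = lam' i"
    and "\<And>i. Suc i < n \<Longrightarrow> a i = a' i" "\<And>i. Suc i < n \<Longrightarrow> b i = b' i"
  shows "gt_sum q n lam x a b = gt_sum q n lam' x a' b'"
  using assms
proof (induction n arbitrary: lam lam' a a')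
  case (Suc n)
  have rows: "gt_rows n lam = gt_rows n lam'"
    unfolding gt_rows_def using Suc.prems(1) by (intro PiE_cong) simp
  have inner: "gt_sum q n mu x (\<lambda>i. a (Suc i)) b = gt_sum q n mu x (\<lambda>i. a' (Suc i)) b'" for mu
    using Suc.prems by (intro Suc.IH) auto
  have weights:
    "(\<Prod>r<n. gt_weight q (x n) (a r) (b r) (nat (lam r - mu r)) (nat (mu r - lam (Suc r)))) =
     (\<Prod>r<n. gt_weight q (x n) (a' r) (b' r) (nat (lam' r - mu r)) (nat (mu r - lam' (Suc r))))" for mu
    using Suc.prems by (intro prod.cong) auto
  have size: "(\<Sum>i<Suc n. lam i) = (\<Sum>i<Suc n. lam' i)"
    using Suc.prems by (intro sum.cong) auto
  show ?case
    by (simp only: gt_sum.simps rows inner weights size)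
qed simp

section \<open>Comparison with the spin q-Whittaker polynomials\<close>

text \<open>
  A shift leaves all gaps unchanged, so only the powers of the variables move: each branching
  step contributes one more \<open>x n powi k\<close>.
\<close>

lemma gt_sum_shift:
  assumes "\<And>i. i < n \<Longrightarrow> x i \<noteq> 0"
  shows "gt_sum q n (\<lambda>i. lam i + k) x a b = (\<Prod>i<n. x i) powi k * gt_sum q n lam x a b"
  using assms
proof (induction n arbitrary: lam a)
  case (Suc n)
  let ?sh = "\<lambda>mu. \<lambda>i\<in>{..<n}. mu i + k"
  let ?W = "\<lambda>lam mu. \<Prod>r<n. gt_weight q (x n) (a r) (b r) (nat (lam r - mu r)) (nat (mu r - lam (Suc r)))"
  have sh_sum: "gt_sum q n (?sh mu) x a' b = (\<Prod>i<n. x i) powi k * gt_sum q n mu x a' b" for mu a'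
  proof -
    have "gt_sum q n (?sh mu) x a' b = gt_sum q n (\<lambda>i. mu i + k) x a' b"
      by (intro gt_sum_cong) auto
    also have "\<dots> = (\<Prod>i<n. x i) powi k * gt_sum q n mu x a' b"
      using Suc by auto
    finally show ?thesis .
  qed
  have sh_weight: "?W (\<lambda>i. lam i + k) (?sh mu) = ?W lam mu" for mu
    by (intro prod.cong) auto
  have xn: "x n \<noteq> 0"
    using Suc.prems by simp
  \<comment> \<open>The two rows have \<open>n + 1\<close> and \<open>n\<close> entries, so one \<open>k\<close> is left over in the exponent.\<close>
  have sh_pow: "x n powi ((\<Sum>i<Suc n. lam i + k) - (\<Sum>i<n. ?sh mu i)) =
      x n powi k * x n powi ((\<Sum>i<Suc n. lam i) - (\<Sum>i<n. mu i))" for mu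
  proof -
    have "(\<Sum>i<Suc n. lam i + k) - (\<Sum>i<n. ?sh mu i) = k + ((\<Sum>i<Suc n. lam i) - (\<Sum>i<n. mu i))"
      by (simp add: sum.distrib algebra_simps)
    then show ?thesis
      by (simp only: power_int_add[OF disjI1[OF xn]])
  qed
  have bij: "bij_betw ?sh (gt_rows n lam) (gt_rows n (\<lambda>i. lam i + k))"
    by (rule bij_betw_byWitness[where f' = "\<lambda>mu. \<lambda>i\<in>{..<n}. mu i - k"])
      (fastforce simp: gt_rows_def PiE_iff extensional_def fun_eq_iff le_diff_eq diff_le_eq)+
  have "gt_sum q (Suc n) (\<lambda>i. lam i + k) x a b =
      (\<Sum>mu\<in>gt_rows n lam. gt_sum q n (?sh mu) x (\<lambda>i. a (Suc i)) b *
        (x n powi ((\<Sum>i<Suc n. lam i + k) - (\<Sum>i<n. ?sh mu i)) * ?W (\<lambda>i. lam i + k) (?sh mu)))"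
    unfolding gt_sum.simps by (rule sum.reindex_bij_betw[OF bij, symmetric])
  also have "\<dots> = (\<Sum>mu\<in>gt_rows n lam. (\<Prod>i<Suc n. x i) powi k *
      (gt_sum q n mu x (\<lambda>i. a (Suc i)) b *
        (x n powi ((\<Sum>i<Suc n. lam i) - (\<Sum>i<n. mu i)) * ?W lam mu)))"
    unfolding sh_sum sh_weight sh_pow
    by (intro sum.cong) (simp_all add: power_int_mult_distrib mult_ac)
  also have "\<dots> = (\<Prod>i<Suc n. x i) powi k * gt_sum q (Suc n) lam x a b"
    by (simp add: sum_distrib_left)
  finally show ?case .
qed simp

lemma qpoch_q_nonzero:
  assumes "norm q < 1"
  shows "qpoch q q k \<noteq> 0"
proof -
  have "q ^ Suc i \<noteq> 1" for i
  proof
    assume "q ^ Suc i = 1"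
    then have "norm q ^ Suc i = 1"
      by (metis norm_one norm_power)
    moreover have "norm q ^ Suc i < 1"
      using power_less_one_iff[of "norm q" "Suc i"] assms by simp
    ultimately show False
      by simp
  qed
  then show ?thesis
    by (auto simp: qpoch_def)
qed

text \<open>
  The factor \<open>r = n\<close> of the left-hand side reduces to the quotient of \<open>qpoch q q (lam n)\<close> by itself.
  It is 1 because \<open>norm q < 1\<close> keeps the denominator away from 0.
\<close>

lemma spin_qW_skew_eq_gt_weight:
  assumes q: "norm q < 1" and lam: "lam \<in> partitions_le (Suc n)" and mu: "mu \<in> partitions_le n"
    and il: "interlaces mu lam" and c: "c n = 0"
  shows "spin_qW_skew q (Suc n) lam mu x c d =
    x powi ((\<Sum>i<Suc n. int (lam i)) - (\<Sum>i<n. int (mu i))) *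
    (\<Prod>r<n. gt_weight q x (c r) (d r) (lam r - mu r) (mu r - lam (Suc r)))"
proof -
  have out: "mu n = 0" "lam (Suc n) = 0"
    using lam mu by (auto simp: partitions_le_def)
  have ord: "mu i \<le> lam i" "lam (Suc i) \<le> mu i" for i
    using il by (auto simp: interlaces_def)
  have le: "(\<Sum>i<Suc n. mu i) \<le> (\<Sum>i<Suc n. lam i)"
    by (intro sum_mono ord)
  have "int ((\<Sum>i<Suc n. lam i) - (\<Sum>i<Suc n. mu i)) = (\<Sum>i<Suc n. int (lam i)) - (\<Sum>i<n. int (mu i))"
    using out by (simp only: of_nat_diff[OF le]) simp
  then have pow: "x ^ ((\<Sum>i<Suc n. lam i) - (\<Sum>i<Suc n. mu i)) =
      x powi ((\<Sum>i<Suc n. int (lam i)) - (\<Sum>i<n. int (mu i)))"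
    by (metis power_int_of_nat)
  have "lam r - mu r + (mu r - lam (Suc r)) = lam r - lam (Suc r)" for r
    using ord[of r] by simp
  then have factor: "qpoch (c r / x) q (lam r - mu r) * qpoch (x * d r) q (mu r - lam (Suc r)) *
        qpoch q q (lam r - lam (Suc r)) /
      (qpoch q q (lam r - mu r) * qpoch q q (mu r - lam (Suc r)) *
        qpoch (c r * d r) q (lam r - lam (Suc r))) =
      gt_weight q x (c r) (d r) (lam r - mu r) (mu r - lam (Suc r))" for r
    by (simp add: gt_weight_def)
  have last: "gt_weight q x (c n) (d n) (lam n - mu n) (mu n - lam (Suc n)) = 1"
    using qpoch_q_nonzero[OF q] out c by (simp add: gt_weight_def) (simp add: qpoch_def)
  show ?thesis
    unfolding spin_qW_skew_def pow factor using il last by simp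
qed

text \<open>
  The condition \<open>c (n - 1) = 0\<close> is inherited in the recursion, because the branching drops the
  first \<open>c\<close>-parameter and keeps the last one.
\<close>

lemma spin_qW_eq_gt_sum:
  assumes "norm q < 1" "lam \<in> partitions_le n" "n > 0 \<Longrightarrow> c (n - 1) = 0"
  shows "spin_qW q n lam x c d = gt_sum q n (\<lambda>i. int (lam i)) x c d"
  using assms
proof (induction n arbitrary: lam c)
  case (Suc n)
  let ?emb = "\<lambda>mu. \<lambda>i\<in>{..<n}. int (mu i)"
  let ?M = "{mu. mu \<in> partitions_le n \<and> interlaces mu lam}"
  have lam0: "lam i = 0" if "i \<ge> Suc n" for i
    using Suc.prems(2) that by (auto simp: partitions_le_def)
  have bij: "bij_betw ?emb ?M (gt_rows n (\<lambda>i. int (lam i)))"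
  proof (rule bij_betw_byWitness[where f' = "\<lambda>mu i. if i < n then nat (mu i) else 0"])
    show "\<forall>mu\<in>?M. (\<lambda>i. if i < n then nat (?emb mu i) else 0) = mu"
      by (auto simp: partitions_le_def fun_eq_iff)
    show "\<forall>mu\<in>gt_rows n (\<lambda>i. int (lam i)). ?emb (\<lambda>i. if i < n then nat (mu i) else 0) = mu"
    proof
      fix mu assume mu: "mu \<in> gt_rows n (\<lambda>i. int (lam i))"
      have "0 \<le> mu i" if "i < n" for i
        using gt_rowsD(1)[OF mu that] by simp
      moreover have "mu \<in> extensional {..<n}"
        using mu by (auto simp: gt_rows_def PiE_iff)
      ultimately show "?emb (\<lambda>i. if i < n then nat (mu i) else 0) = mu"
        by (auto simp: fun_eq_iff extensional_def)
    qed
    show "?emb ` ?M \<subseteq> gt_rows n (\<lambda>i. int (lam i))"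
      by (auto simp: gt_rows_def interlaces_def split: if_splits)
    show "(\<lambda>mu i. if i < n then nat (mu i) else 0) ` gt_rows n (\<lambda>i. int (lam i)) \<subseteq> ?M"
    proof clarsimp
      fix mu assume mu: "mu \<in> gt_rows n (\<lambda>i. int (lam i))"
      let ?nu = "\<lambda>i. if i < n then nat (mu i) else 0"
      have il: "interlaces ?nu lam"
        unfolding interlaces_def
      proof
        fix i
        show "?nu i \<le> lam i \<and> lam (Suc i) \<le> ?nu i"
        proof (cases "i < n")
          case True
          then show ?thesis
            using gt_rowsD[OF mu True] True by (simp add: nat_le_iff le_nat_iff)
        next
          case False
          then show ?thesis
            using lam0[of "Suc i"] by simp
        qed
      qed
      have "?nu (Suc i) \<le> ?nu i" for i
        using il unfolding interlaces_def by (meson order_trans)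
      then have "antimono ?nu"
        unfolding antimono_iff_le_Suc by blast
      with il show "?nu \<in> partitions_le n \<and> interlaces ?nu lam"
        by (simp add: partitions_le_def)
    qed
  qed
  have "spin_qW q (Suc n) lam x c d =
      (\<Sum>mu\<in>?M. gt_sum q n (?emb mu) x (\<lambda>i. c (Suc i)) d *
        (x n powi ((\<Sum>i<Suc n. int (lam i)) - (\<Sum>i<n. ?emb mu i)) *
         (\<Prod>r<n. gt_weight q (x n) (c r) (d r)
            (nat (int (lam r) - ?emb mu r)) (nat (?emb mu r - int (lam (Suc r)))))))"
    unfolding spin_qW.simps
  proof (rule sum.cong)
    fix mu assume "mu \<in> ?M"
    then have mu: "mu \<in> partitions_le n" "interlaces mu lam"
      by auto
    have "spin_qW q n mu x (\<lambda>i. c (Suc i)) d = gt_sum q n (\<lambda>i. int (mu i)) x (\<lambda>i. c (Suc i)) d"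
      using Suc.prems mu by (intro Suc.IH) auto
    also have "\<dots> = gt_sum q n (?emb mu) x (\<lambda>i. c (Suc i)) d"
      by (intro gt_sum_cong) auto
    finally have inner: "spin_qW q n mu x (\<lambda>i. c (Suc i)) d = gt_sum q n (?emb mu) x (\<lambda>i. c (Suc i)) d" .
    have skew: "spin_qW_skew q (Suc n) lam mu (x n) c d =
        x n powi ((\<Sum>i<Suc n. int (lam i)) - (\<Sum>i<n. int (mu i))) *
        (\<Prod>r<n. gt_weight q (x n) (c r) (d r) (lam r - mu r) (mu r - lam (Suc r)))"
      using Suc.prems mu by (intro spin_qW_skew_eq_gt_weight) auto
    have size: "(\<Sum>i<n. ?emb mu i) = (\<Sum>i<n. int (mu i))"
      by (intro sum.cong) auto
    have weights: "(\<Prod>r<n. gt_weight q (x n) (c r) (d r)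
            (nat (int (lam r) - ?emb mu r)) (nat (?emb mu r - int (lam (Suc r))))) =
        (\<Prod>r<n. gt_weight q (x n) (c r) (d r) (lam r - mu r) (mu r - lam (Suc r)))"
      by (intro prod.cong) (auto simp flip: of_nat_diff simp: nat_minus_as_int)
    show "spin_qW q n mu x (\<lambda>i. c (Suc i)) d * spin_qW_skew q (Suc n) lam mu (x n) c d =
        gt_sum q n (?emb mu) x (\<lambda>i. c (Suc i)) d *
        (x n powi ((\<Sum>i<Suc n. int (lam i)) - (\<Sum>i<n. ?emb mu i)) *
         (\<Prod>r<n. gt_weight q (x n) (c r) (d r)
            (nat (int (lam r) - ?emb mu r)) (nat (?emb mu r - int (lam (Suc r))))))"
      unfolding inner skew size weights ..
  qed simp
  also have "\<dots> = gt_sum q (Suc n) (\<lambda>i. int (lam i)) x c d"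
    unfolding gt_sum.simps by (rule sum.reindex_bij_betw[OF bij])
  finally show ?case .
qed simp

lemma spin_f_eq_gt_sum:
  assumes "norm q < 1" "n \<ge> 1" "antimono_on {..<n} lam" "\<And>i. i < n \<Longrightarrow> x i \<noteq> 0"
  shows "spin_f q n lam x a b = gt_sum q n lam x a b"
proof -
  let ?m = "lam (n - 1)"
  let ?p = "\<lambda>i. if i < n then nat (lam i - ?m) else 0"
  have ord: "lam j \<le> lam i" if "i \<le> j" "j < n" for i j
    using assms(3) that by (auto simp: monotone_on_def)
  have "?p j \<le> ?p i" if "i \<le> j" for i j
    using ord[of i j] that by auto
  then have part: "?p \<in> partitions_le n"
    by (auto simp: partitions_le_def intro!: antimonoI)
  have "spin_f_part q n ?p x a b = gt_sum q n (\<lambda>i. int (?p i)) x (a(n - 1 := 0)) (b(n - 1 := 0))"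
    unfolding spin_f_part_def using assms(1) part by (intro spin_qW_eq_gt_sum) auto
  also have "\<dots> = gt_sum q n (\<lambda>i. lam i - ?m) x a b"
  proof (intro gt_sum_cong)
    fix i assume "i < n"
    then show "int (?p i) = lam i - ?m"
      using ord[of i "n - 1"] by simp
  qed auto
  finally show ?thesis
    using gt_sum_shift[of n x q "\<lambda>i. lam i - ?m" ?m a b] assms(4) by (simp add: spin_f_def)
qed

section \<open>Reversal of patterns\<close>

lemma sum_sig_rev: "(\<Sum>i<n. sig_rev n lam i) = - (\<Sum>i<n. lam i)"
  using sum.nat_diff_reindex[of lam n] by (simp add: sig_rev_def rev_seq_def sum_negf)

text \<open>
  Negating and reversing the second row is a bijection between the two index sets, and the
  summands correspond: gap \<open>j\<close> at position \<open>r\<close> becomes gap \<open>k\<close> at position \<open>n - Suc r\<close>, so that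
  \<open>gt_weight_swap\<close> applies factor by factor.
\<close>

lemma gt_sum_rev:
  assumes "\<And>i. i < n \<Longrightarrow> x i \<noteq> 0"
  shows "gt_sum q n (sig_rev n lam) (\<lambda>i. inverse (x i)) (rev_seq (n - 1) b) (rev_seq (n - 1) a) =
    gt_sum q n lam x a b"
  using assms
proof (induction n arbitrary: lam a)
  case (Suc n)
  let ?y = "\<lambda>i. inverse (x i)"
  let ?rv = "\<lambda>mu. restrict (sig_rev n mu) {..<n}"
  have xn: "x n \<noteq> 0"
    using Suc.prems by simp
  have rv_rows: "?rv mu \<in> gt_rows n (sig_rev (Suc n) nu)" if mu: "mu \<in> gt_rows n nu" for mu nu
    unfolding gt_rows_def
  proof (rule PiE_I)
    fix i assume "i \<in> {..<n}"
    then have i: "i < n"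
      by simp
    then have "Suc (n - Suc i) = n - i"
      by simp
    then show "?rv mu i \<in> {sig_rev (Suc n) nu (Suc i)..sig_rev (Suc n) nu i}"
      using i gt_rowsD[OF mu, of "n - Suc i"] by (simp add: sig_rev_def rev_seq_def)
  qed simp
  have rv_rv: "?rv (?rv mu) = mu" if "mu \<in> gt_rows n nu" for mu nu
    using that by (auto simp: gt_rows_def PiE_iff extensional_def fun_eq_iff sig_rev_def rev_seq_def)
  have rows_rev: "gt_rows n (sig_rev (Suc n) (sig_rev (Suc n) lam)) = gt_rows n lam"
    unfolding gt_rows_def by (intro PiE_cong) (auto simp: sig_rev_def rev_seq_def)
  have "gt_sum q (Suc n) (sig_rev (Suc n) lam) ?y (rev_seq n b) (rev_seq n a) =
      gt_sum q (Suc n) lam x a b"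
    unfolding gt_sum.simps
  proof (rule sum.reindex_bij_witness[where i = ?rv and j = ?rv])
    fix mu assume "mu \<in> gt_rows n (sig_rev (Suc n) lam)"
    then show "?rv (?rv mu) = mu" "?rv mu \<in> gt_rows n lam"
      using rv_rv rv_rows[of mu "sig_rev (Suc n) lam"] by (simp_all only: rows_rev)
    have entry: "mu (n - Suc r) = - ?rv mu r" if "r < n" for r
      using that by (simp add: sig_rev_def rev_seq_def)
    have "gt_sum q n (?rv mu) x (\<lambda>i. a (Suc i)) b = gt_sum q n (sig_rev n mu) x (\<lambda>i. a (Suc i)) b"
      by (intro gt_sum_cong) auto
    also have "\<dots> = gt_sum q n (sig_rev n (sig_rev n mu)) ?y
        (rev_seq (n - 1) b) (rev_seq (n - 1) (\<lambda>i. a (Suc i)))"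
      using Suc.prems by (intro Suc.IH[symmetric]) auto
    \<comment> \<open>Branching drops the first parameter of the first sequence and the last of the second; for the
      swapped and reversed sequences these are the last \<open>b\<close> and the first \<open>a\<close>, the same two.\<close>
    also have "\<dots> = gt_sum q n mu ?y (\<lambda>i. rev_seq n b (Suc i)) (rev_seq n a)"
      by (intro gt_sum_cong) (auto simp: sig_rev_def rev_seq_def Suc_diff_Suc)
    finally have inner: "gt_sum q n (?rv mu) x (\<lambda>i. a (Suc i)) b =
        gt_sum q n mu ?y (\<lambda>i. rev_seq n b (Suc i)) (rev_seq n a)" .
    have "(\<Sum>i<n. ?rv mu i) = (\<Sum>i<n. sig_rev n mu i)"
      by (intro sum.cong) auto
    then have "(\<Sum>i<Suc n. lam i) - (\<Sum>i<n. ?rv mu i) =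
        - ((\<Sum>i<Suc n. sig_rev (Suc n) lam i) - (\<Sum>i<n. mu i))"
      by (simp only: sum_sig_rev)
    then have pow: "x n powi ((\<Sum>i<Suc n. lam i) - (\<Sum>i<n. ?rv mu i)) =
        ?y n powi ((\<Sum>i<Suc n. sig_rev (Suc n) lam i) - (\<Sum>i<n. mu i))"
      by (simp only: power_int_minus power_int_inverse)
    have "(\<Prod>r<n. gt_weight q (?y n) (rev_seq n b r) (rev_seq n a r)
          (nat (sig_rev (Suc n) lam r - mu r)) (nat (mu r - sig_rev (Suc n) lam (Suc r)))) =
        (\<Prod>r<n. gt_weight q (?y n) (rev_seq n b (n - Suc r)) (rev_seq n a (n - Suc r))
          (nat (sig_rev (Suc n) lam (n - Suc r) - mu (n - Suc r)))
          (nat (mu (n - Suc r) - sig_rev (Suc n) lam (Suc (n - Suc r)))))"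
      by (rule prod.nat_diff_reindex[symmetric])
    also have "\<dots> = (\<Prod>r<n. gt_weight q (x n) (a r) (b r)
        (nat (lam r - ?rv mu r)) (nat (?rv mu r - lam (Suc r))))"
    proof (rule prod.cong)
      fix r assume "r \<in> {..<n}"
      then have r: "r < n"
        by simp
      then have "rev_seq n b (n - Suc r) = b r" "rev_seq n a (n - Suc r) = a r"
        "sig_rev (Suc n) lam (n - Suc r) = - lam (Suc r)"
        "sig_rev (Suc n) lam (Suc (n - Suc r)) = - lam r"
        by (simp_all add: sig_rev_def rev_seq_def Suc_diff_Suc)
      then show "gt_weight q (?y n) (rev_seq n b (n - Suc r)) (rev_seq n a (n - Suc r))
          (nat (sig_rev (Suc n) lam (n - Suc r) - mu (n - Suc r)))
          (nat (mu (n - Suc r) - sig_rev (Suc n) lam (Suc (n - Suc r)))) =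
        gt_weight q (x n) (a r) (b r) (nat (lam r - ?rv mu r)) (nat (?rv mu r - lam (Suc r)))"
        using xn by (simp add: entry[OF r] gt_weight_swap add.commute)
    qed simp
    finally have weights: "(\<Prod>r<n. gt_weight q (?y n) (rev_seq n b r) (rev_seq n a r)
          (nat (sig_rev (Suc n) lam r - mu r)) (nat (mu r - sig_rev (Suc n) lam (Suc r)))) =
        (\<Prod>r<n. gt_weight q (x n) (a r) (b r)
          (nat (lam r - ?rv mu r)) (nat (?rv mu r - lam (Suc r))))" .
    show "gt_sum q n (?rv mu) x (\<lambda>i. a (Suc i)) b *
        (x n powi ((\<Sum>i<Suc n. lam i) - (\<Sum>i<n. ?rv mu i)) *
         (\<Prod>r<n. gt_weight q (x n) (a r) (b r)
            (nat (lam r - ?rv mu r)) (nat (?rv mu r - lam (Suc r))))) =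
      gt_sum q n mu ?y (\<lambda>i. rev_seq n b (Suc i)) (rev_seq n a) *
        (?y n powi ((\<Sum>i<Suc n. sig_rev (Suc n) lam i) - (\<Sum>i<n. mu i)) *
         (\<Prod>r<n. gt_weight q (?y n) (rev_seq n b r) (rev_seq n a r)
            (nat (sig_rev (Suc n) lam r - mu r)) (nat (mu r - sig_rev (Suc n) lam (Suc r)))))"
      unfolding inner pow weights ..
  next
    fix mu assume "mu \<in> gt_rows n lam"
    then show "?rv (?rv mu) = mu" "?rv mu \<in> gt_rows n (sig_rev (Suc n) lam)"
      by (fact rv_rv, fact rv_rows)
  qed
  then show ?case
    by simp
qed simp

theorem proposition2p3:
  fixes q :: complex and n :: nat
    and a b :: "nat \<Rightarrow> complex"
    and lam :: "nat \<Rightarrow> int"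
    and x :: "nat \<Rightarrow> complex"
  assumes "norm q < 1"
    and "n \<ge> 1"
    and "\<And>i. i < n - 1 \<Longrightarrow> norm (a i) < 1"
    and "\<And>i. i < n - 1 \<Longrightarrow> norm (b i) < 1"
    and "antimono_on {..<n} lam"
    and "\<And>i. i < n \<Longrightarrow> x i \<noteq> 0"
  shows "spin_f q n lam x a b =
    spin_f q n (sig_rev n lam) (\<lambda>i. inverse (x i)) (rev_seq (n - 1) b) (rev_seq (n - 1) a)"
proof -
  have "antimono_on {..<n} (sig_rev n lam)"
    using assms(5) by (auto simp: monotone_on_def sig_rev_def rev_seq_def)
  then have "spin_f q n (sig_rev n lam) (\<lambda>i. inverse (x i)) (rev_seq (n - 1) b) (rev_seq (n - 1) a) =
      gt_sum q n (sig_rev n lam) (\<lambda>i. inverse (x i)) (rev_seq (n - 1) b) (rev_seq (n - 1) a)"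
    using assms by (intro spin_f_eq_gt_sum) auto
  also have "\<dots> = gt_sum q n lam x a b"
    using assms by (intro gt_sum_rev) auto
  also have "\<dots> = spin_f q n lam x a b"
    using assms by (intro spin_f_eq_gt_sum[symmetric]) auto
  finally show ?thesis
    by simp
qed

end
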